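(* Let $G$ be a group and let $a,b\in\{0,1\}^G$. Then $a$ and $b$ are isomorphic if and only if there exist a generalised projection $F:\overline{\{R_gb:g\in G\}}\to\mathbb{C}$ and a transitive point $x\in\overline{\{R_gb:g\in G\}}$ such that $F(R_gx)=a(g)$ for every $g\in G$.
   Context: For a group $G$ with identity $e$, a topological dynamical $G$-system $(X,(T_g)_{g\in G})$ is a compact Hausdorff space $X$ with continuous maps $T_g:X\to X$ such that $T_{gh}=T_gT_h$ and $T_e=\mathrm{id}_X$. A point $x\in X$ is transitive if $\{T_gx:g\in G\}$ is dense in $X$. For bounded $f:G\to\mathbb{C}$, a $G$-system $(X,(T_g))$ is a Furstenberg system of $f$ if there exist $F\in C(X)$ and a transitive point $x_0\in X$ with $f(g)=F(T_gx_0)$ for all $g\in G$, and for any $x\ne y$ in $X$ there is $g\in G$ with $F(T_gx)\neq F(T_gy)$; it is unique up to topological isomorphism (equivariant homeomorphism). On $\{0,1\}^G$ (product topology) the right shift is $R_g\big((x(u))_{u\in G}\big)=(x(ug))_{u\in G}$. A point $a\in\{0,1\}^G$ is viewed as a function $G\to\{0,1\}$; its Furstenberg system may be realised as $(\overline{\{R_ga:g\in G\}},(R_g))$. Points $a,b\in\{0,1\}^G$ are isomorphic if their Furstenberg systems are topologically isomorphic. Let $Y=\overline{\{R_gb:g\in G\}}$. A function $F:Y\to\mathbb{C}$ depends on finitely many parameters if there exist $g_1,\dots,g_k\in G$ such that $F(x)=F(y)$ for any $x,y\in Y$ with $x(g_i)=y(g_i)$ for all $i=1,\dots,k$. A generalised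 projection on $Y$ is a continuous function $F:Y\to\mathbb{C}$ that depends on finitely many parameters and whose $G$-orbit separates points, i.e. for $x\neq y$ in $Y$ there is $g\in G$ with $F(R_gx)\ne F(R_gy)$. Transitivity of $x\in Y$ is with respect to the system $(Y,(R_g))$. *)

theory Defs
  imports "HOL-Analysis.Analysis" "HOL-Algebra.Group"
begin

text \<open>Only the topological \<open>closure_of\<close> is used here.\<close>

no_notation eq_closure_of (\<open>closure'_of\<index>\<close>)

definition dynamical_system ::
    "('g, 'm) monoid_scheme \<Rightarrow> 'x topology \<Rightarrow> ('g \<Rightarrow> 'x \<Rightarrow> 'x) \<Rightarrow> bool"
  where "dynamical_system G X T \<longleftrightarrow>
    compact_space X \<and> Hausdorff_space X \<and>
    (\<forall>g\<in>carrier G. continuous_map X X (T g)) \<and>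
    (\<forall>g\<in>carrier G. \<forall>h\<in>carrier G. \<forall>x\<in>topspace X. T (g \<otimes>\<^bsub>G\<^esub> h) x = T g (T h x)) \<and>
    (\<forall>x\<in>topspace X. T \<one>\<^bsub>G\<^esub> x = x)"

definition transitive_point ::
    "('g, 'm) monoid_scheme \<Rightarrow> 'x topology \<Rightarrow> ('g \<Rightarrow> 'x \<Rightarrow> 'x) \<Rightarrow> 'x \<Rightarrow> bool"
  where "transitive_point G X T x \<longleftrightarrow>
    x \<in> topspace X \<and> X closure_of ((\<lambda>g. T g x) ` carrier G) = topspace X"

definition orbit_separates_points ::
    "('g, 'm) monoid_scheme \<Rightarrow> 'x topology \<Rightarrow> ('g \<Rightarrow> 'x \<Rightarrow> 'x) \<Rightarrow> ('x \<Rightarrow> complex) \<Rightarrow> bool"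
  where "orbit_separates_points G X T F \<longleftrightarrow>
    (\<forall>x\<in>topspace X. \<forall>y\<in>topspace X. x \<noteq> y \<longrightarrow> (\<exists>g\<in>carrier G. F (T g x) \<noteq> F (T g y)))"

text \<open>No boundedness of \<open>f\<close> is required below: it follows from the compactness of \<open>X\<close>.\<close>

definition furstenberg_system ::
    "('g, 'm) monoid_scheme \<Rightarrow> ('g \<Rightarrow> complex) \<Rightarrow> 'x topology \<Rightarrow> ('g \<Rightarrow> 'x \<Rightarrow> 'x) \<Rightarrow> bool"
  where "furstenberg_system G f X T \<longleftrightarrow>
    dynamical_system G X T \<and>
    (\<exists>F x\<^sub>0. continuous_map X euclidean F \<and> transitive_point G X T x\<^sub>0 \<and>
      (\<forall>g\<in>carrier G. f g = F (T g x\<^sub>0)) \<and> orbit_separates_points G X T F)"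

definition topologically_isomorphic ::
    "('g, 'm) monoid_scheme \<Rightarrow> 'x topology \<Rightarrow> ('g \<Rightarrow> 'x \<Rightarrow> 'x) \<Rightarrow>
      'y topology \<Rightarrow> ('g \<Rightarrow> 'y \<Rightarrow> 'y) \<Rightarrow> bool"
  where "topologically_isomorphic G X T Y S \<longleftrightarrow>
    (\<exists>\<phi>. homeomorphic_map X Y \<phi> \<and>
      (\<forall>g\<in>carrier G. \<forall>x\<in>topspace X. \<phi> (T g x) = S g (\<phi> x)))"

text \<open>The symbols 0 and 1 are taken in the complex numbers, so that a point of \<open>{0,1}\<^sup>G\<close> is itself
  a complex-valued function on \<open>G\<close>. Points are extensional functions on \<open>carrier G\<close>.\<close>

definition binary_space :: "('g, 'm) monoid_scheme \<Rightarrow> ('g \<Rightarrow> complex) topology"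
  where "binary_space G = product_topology (\<lambda>_. discrete_topology {0, 1}) (carrier G)"

definition right_shift :: "('g, 'm) monoid_scheme \<Rightarrow> 'g \<Rightarrow> ('g \<Rightarrow> 'c) \<Rightarrow> 'g \<Rightarrow> 'c"
  where "right_shift G g x = (\<lambda>u\<in>carrier G. x (u \<otimes>\<^bsub>G\<^esub> g))"

definition orbit_closure :: "('g, 'm) monoid_scheme \<Rightarrow> ('g \<Rightarrow> complex) \<Rightarrow> ('g \<Rightarrow> complex) topology"
  where "orbit_closure G b = subtopology (binary_space G)
    (binary_space G closure_of ((\<lambda>g. right_shift G g b) ` carrier G))"

text \<open>HOL cannot quantify over the underlying types of the two Furstenberg systems inside a formula;
  type \<open>'g \<Rightarrow> complex\<close> suffices, since every point of \<open>{0,1}\<^sup>G\<close> has a Furstenberg system there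
  and Furstenberg systems of any type are unique up to isomorphism. The lemmas
  \<open>furstenberg_system_orbit_closure\<close>, \<open>isomorphic_points_iff_systems\<close> and
  \<open>isomorphic_points_iff_orbit_closures\<close> below show that the choice of systems and types
  does not matter.\<close>

definition isomorphic_points ::
    "('g, 'm) monoid_scheme \<Rightarrow> ('g \<Rightarrow> complex) \<Rightarrow> ('g \<Rightarrow> complex) \<Rightarrow> bool"
  where "isomorphic_points G a b \<longleftrightarrow>
    (\<exists>(X :: ('g \<Rightarrow> complex) topology) T (Y :: ('g \<Rightarrow> complex) topology) S.
      furstenberg_system G a X T \<and> furstenberg_system G b Y S \<and>
      topologically_isomorphic G X T Y S)"

definition depends_on_finitely_many ::
    "('g, 'm) monoid_scheme \<Rightarrow> ('g \<Rightarrow> complex) topology \<Rightarrow> (('g \<Rightarrow> complex) \<Rightarrow> complex) \<Rightarrow> bool"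
  where "depends_on_finitely_many G Y F \<longleftrightarrow>
    (\<exists>A. finite A \<and> A \<subseteq> carrier G \<and>
      (\<forall>x\<in>topspace Y. \<forall>y\<in>topspace Y. (\<forall>g\<in>A. x g = y g) \<longrightarrow> F x = F y))"

definition generalised_projection ::
    "('g, 'm) monoid_scheme \<Rightarrow> ('g \<Rightarrow> complex) topology \<Rightarrow> (('g \<Rightarrow> complex) \<Rightarrow> complex) \<Rightarrow> bool"
  where "generalised_projection G Y F \<longleftrightarrow>
    continuous_map Y euclidean F \<and> depends_on_finitely_many G Y F \<and>
    orbit_separates_points G Y (right_shift G) F"


subsection \<open>Existence and uniqueness of Furstenberg systems\<close>

lemma topspace_binary_space: "topspace (binary_space G) = carrier G \<rightarrow>\<^sub>E {0, 1}"
  by (simp add: binary_space_def)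

lemma right_shift_mult:
  assumes "group G" "g \<in> carrier G" "h \<in> carrier G"
  shows "right_shift G (g \<otimes>\<^bsub>G\<^esub> h) x = right_shift G g (right_shift G h x)"
proof -
  interpret group G by fact
  show ?thesis
    using assms(2,3) by (auto simp: right_shift_def m_assoc intro!: restrict_ext)
qed

lemma right_shift_one:
  assumes "group G" "x \<in> extensional (carrier G)"
  shows "right_shift G \<one>\<^bsub>G\<^esub> x = x"
proof -
  interpret group G by fact
  show ?thesis
    using assms(2) by (auto simp: right_shift_def fun_eq_iff extensional_def)
qed

lemma continuous_map_right_shift:
  assumes "group G" "g \<in> carrier G"
  shows "continuous_map (product_topology (\<lambda>_. X) (carrier G))
    (product_topology (\<lambda>_. X) (carrier G)) (right_shift G g)"
proof -
  interpret group G by fact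
  show ?thesis
    unfolding right_shift_def
    using assms(2) by (subst continuous_map_componentwise)
      (auto intro!: continuous_map_product_projection)
qed

lemma topologically_isomorphic_sym:
  assumes "dynamical_system G X T" "topologically_isomorphic G X T Y S"
  shows "topologically_isomorphic G Y S X T"
proof -
  obtain \<phi> where \<phi>: "homeomorphic_map X Y \<phi>"
    "\<And>g x. \<lbrakk>g \<in> carrier G; x \<in> topspace X\<rbrakk> \<Longrightarrow> \<phi> (T g x) = S g (\<phi> x)"
    using assms(2) by (auto simp: topologically_isomorphic_def)
  obtain \<psi> where hm: "homeomorphic_maps X Y \<phi> \<psi>"
    using \<phi>(1) by (auto simp: homeomorphic_map_maps)
  have psi: "homeomorphic_map Y X \<psi>"
    using hm homeomorphic_maps_map by blast
  have "\<psi> (S g y) = T g (\<psi> y)" if "g \<in> carrier G" "y \<in> topspace Y" for g y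
  proof -
    have 1: "\<psi> y \<in> topspace X" "\<phi> (\<psi> y) = y"
      using hm that by (auto simp: homeomorphic_maps_def continuous_map_def)
    have "T g (\<psi> y) \<in> topspace X"
      using assms(1) that 1 by (auto simp: dynamical_system_def continuous_map_def)
    then have "\<psi> (\<phi> (T g (\<psi> y))) = T g (\<psi> y)"
      using hm by (auto simp: homeomorphic_maps_def)
    then show ?thesis
      using \<phi>(2)[OF that(1) 1(1)] 1(2) by simp
  qed
  then show ?thesis
    using psi by (auto simp: topologically_isomorphic_def)
qed

lemma topologically_isomorphic_trans:
  assumes "topologically_isomorphic G X T Y S" "topologically_isomorphic G Y S Z R"
  shows "topologically_isomorphic G X T Z R"
proof -
  obtain \<phi> where \<phi>: "homeomorphic_map X Y \<phi>"
    "\<And>g x. \<lbrakk>g \<in> carrier G; x \<in> topspace X\<rbrakk> \<Longrightarrow> \<phi> (T g x) = S g (\<phi> x)"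
    using assms(1) by (auto simp: topologically_isomorphic_def)
  obtain \<psi> where \<psi>: "homeomorphic_map Y Z \<psi>"
    "\<And>g x. \<lbrakk>g \<in> carrier G; x \<in> topspace Y\<rbrakk> \<Longrightarrow> \<psi> (S g x) = R g (\<psi> x)"
    using assms(2) by (auto simp: topologically_isomorphic_def)
  have "\<phi> x \<in> topspace Y" if "x \<in> topspace X" for x
    using \<phi>(1) that homeomorphic_imp_surjective_map by blast
  then have "homeomorphic_map X Z (\<psi> \<circ> \<phi>) \<and>
      (\<forall>g\<in>carrier G. \<forall>x\<in>topspace X. (\<psi> \<circ> \<phi>) (T g x) = R g ((\<psi> \<circ> \<phi>) x))"
    using \<phi> \<psi> homeomorphic_map_compose by auto
  then show ?thesis
    unfolding topologically_isomorphic_def by blast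
qed

text \<open>Every Furstenberg system of \<open>f\<close> is isomorphic to the shift orbit closure of \<open>f\<close> in
  the product of copies of the complex plane.\<close>

lemma furstenberg_system_universal:
  assumes "group G" "furstenberg_system G f X T"
  defines "P \<equiv> product_topology (\<lambda>_. euclidean :: complex topology) (carrier G)"
  shows "topologically_isomorphic G X T
    (subtopology P (P closure_of ((\<lambda>g. right_shift G g f) ` carrier G))) (right_shift G)"
proof -
  interpret group G by fact
  obtain F x\<^sub>0 where sys: "dynamical_system G X T" and F: "continuous_map X euclidean F"
    and x0: "transitive_point G X T x\<^sub>0" and f: "\<And>g. g \<in> carrier G \<Longrightarrow> f g = F (T g x\<^sub>0)"
    and sep: "orbit_separates_points G X T F"
    using assms(2) by (auto simp: furstenberg_system_def)
  have cont: "continuous_map X X (T g)" if "g \<in> carrier G" for g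
    using sys that by (auto simp: dynamical_system_def)
  have T_in: "T g x \<in> topspace X" if "g \<in> carrier G" "x \<in> topspace X" for g x
    using cont[OF that(1)] that(2) by (auto simp: continuous_map_def)
  have x0': "x\<^sub>0 \<in> topspace X" using x0 by (simp add: transitive_point_def)
  define \<Phi> where "\<Phi> x = (\<lambda>g\<in>carrier G. F (T g x))" for x
  have equiv: "\<Phi> (T g x) = right_shift G g (\<Phi> x)" if "g \<in> carrier G" "x \<in> topspace X" for g x
    using sys that by (auto simp: \<Phi>_def right_shift_def dynamical_system_def intro!: restrict_ext)
  have contP: "continuous_map X P \<Phi>"
    unfolding P_def \<Phi>_def
  proof (subst continuous_map_componentwise, intro conjI ballI)
    fix k assume k: "k \<in> carrier G"
    have "continuous_map X euclidean (F \<circ> T k)"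
      using continuous_map_compose[OF cont[OF k] F] .
    then show "continuous_map X euclidean (\<lambda>x. (\<lambda>g\<in>carrier G. F (T g x)) k)"
      using k by (simp add: o_def)
  qed auto
  have "inj_on \<Phi> (topspace X)"
  proof (rule inj_onI, rule ccontr)
    fix x y assume xy: "x \<in> topspace X" "y \<in> topspace X" "\<Phi> x = \<Phi> y" "x \<noteq> y"
    then obtain g where g: "g \<in> carrier G" "F (T g x) \<noteq> F (T g y)"
      using sep by (auto simp: orbit_separates_points_def)
    then show False
      using fun_cong[OF xy(3), of g] by (simp add: \<Phi>_def)
  qed
  moreover have HP: "Hausdorff_space P"
    by (simp add: P_def Hausdorff_space_product_topology)
  moreover have "closed_map X P \<Phi>"
    using continuous_imp_closed_map[OF contP _ HP] sys by (auto simp: dynamical_system_def)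
  ultimately have emb: "homeomorphic_map X (subtopology P (\<Phi> ` topspace X)) \<Phi>"
    using contP injective_closed_imp_embedding_map
    by (auto simp: embedding_map_def)
  have f0: "right_shift G g f = \<Phi> (T g x\<^sub>0)" if "g \<in> carrier G" for g
  proof -
    have "right_shift G g f = right_shift G g (\<Phi> x\<^sub>0)"
      using f that by (auto simp: right_shift_def \<Phi>_def intro!: restrict_ext)
    then show ?thesis using equiv[OF that x0'] by simp
  qed
  have "\<Phi> ` topspace X = \<Phi> ` (X closure_of ((\<lambda>g. T g x\<^sub>0) ` carrier G))"
    using x0 by (simp add: transitive_point_def)
  also have "\<dots> = P closure_of (\<Phi> ` ((\<lambda>g. T g x\<^sub>0) ` carrier G))" (is "\<Phi> ` (X closure_of ?O) = _")
  proof (rule equalityI)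
    show "\<Phi> ` (X closure_of ?O) \<subseteq> P closure_of (\<Phi> ` ?O)"
      using continuous_map_image_closure_subset[OF contP] .
    have "closedin P (\<Phi> ` (X closure_of ?O))"
      using \<open>closed_map X P \<Phi>\<close> closedin_closure_of unfolding closed_map_def by blast
    moreover have "?O \<subseteq> X closure_of ?O"
      using T_in x0' by (intro closure_of_subset) auto
    ultimately show "P closure_of (\<Phi> ` ?O) \<subseteq> \<Phi> ` (X closure_of ?O)"
      by (intro closure_of_minimal image_mono)
  qed
  also have "\<Phi> ` ((\<lambda>g. T g x\<^sub>0) ` carrier G) = (\<lambda>g. right_shift G g f) ` carrier G"
    using f0 by (auto simp: image_image)
  finally show ?thesis
    using emb equiv by (auto simp: topologically_isomorphic_def)
qed

lemma furstenberg_system_unique: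
  assumes "group G" "furstenberg_system G f X T" "furstenberg_system G f Y S"
  shows "topologically_isomorphic G X T Y S"
proof -
  have "dynamical_system G Y S"
    using assms(3) by (simp add: furstenberg_system_def)
  from topologically_isomorphic_sym[OF this furstenberg_system_universal[OF assms(1,3)]]
  show ?thesis
    by (rule topologically_isomorphic_trans[OF furstenberg_system_universal[OF assms(1,2)]])
qed

lemma furstenberg_system_orbit_closure:
  assumes "group G" "a \<in> carrier G \<rightarrow>\<^sub>E {0, 1}"
  shows "furstenberg_system G a (orbit_closure G a) (right_shift G)"
proof -
  interpret group G by fact
  let ?B = "binary_space G" and ?O = "(\<lambda>g. right_shift G g a) ` carrier G"
  let ?C = "?B closure_of ?O"
  have top: "topspace (orbit_closure G a) = ?C"
    unfolding orbit_closure_def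
    using closure_of_subset_topspace[of ?B ?O] by (simp add: Int_absorb1)
  have contB: "continuous_map ?B ?B (right_shift G g)" if "g \<in> carrier G" for g
    unfolding binary_space_def using continuous_map_right_shift[OF assms(1) that] .
  have aB: "a \<in> topspace ?B" using assms(2) by (simp add: topspace_binary_space)
  have OB: "?O \<subseteq> topspace ?B"
    using contB aB by (auto simp: continuous_map_def)
  have OC: "?O \<subseteq> ?C" using closure_of_subset[OF OB] .
  have CE: "?C \<subseteq> carrier G \<rightarrow>\<^sub>E {0, 1}"
    using closure_of_subset_topspace[of ?B ?O] by (simp add: topspace_binary_space)
  have one: "right_shift G \<one>\<^bsub>G\<^esub> x = x" if "x \<in> carrier G \<rightarrow>\<^sub>E {0, 1}" for x
    using that right_shift_one[OF assms(1)] by (auto simp: PiE_def)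
  have aO: "a \<in> ?O" using one[OF assms(2)] by force
  have shiftC: "right_shift G g ` ?C \<subseteq> ?C" if "g \<in> carrier G" for g
  proof -
    have "right_shift G g ` ?C \<subseteq> ?B closure_of (right_shift G g ` ?O)"
      using continuous_map_image_closure_subset[OF contB[OF that]] .
    also have "right_shift G g ` ?O \<subseteq> ?O"
      using that right_shift_mult[OF assms(1), symmetric] by auto
    then have "?B closure_of (right_shift G g ` ?O) \<subseteq> ?C" by (rule closure_of_mono)
    finally show ?thesis .
  qed
  have "dynamical_system G (orbit_closure G a) (right_shift G)"
    unfolding dynamical_system_def
  proof (intro conjI ballI)
    have "compact_space ?B"
      by (auto simp: binary_space_def compact_space_product_topology compact_space_discrete_topology)
    then show "compact_space (orbit_closure G a)"
      unfolding orbit_closure_def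
      by (intro compact_space_subtopology closedin_compact_space) auto
    have "Hausdorff_space ?B"
      by (auto simp: binary_space_def Hausdorff_space_product_topology)
    then show "Hausdorff_space (orbit_closure G a)"
      unfolding orbit_closure_def by (rule Hausdorff_space_subtopology)
  next
    fix g assume g: "g \<in> carrier G"
    show "continuous_map (orbit_closure G a) (orbit_closure G a) (right_shift G g)"
      unfolding orbit_closure_def
      using contB[OF g] shiftC[OF g]
      by (auto simp: continuous_map_in_subtopology intro!: continuous_map_from_subtopology)
  next
    fix g h x assume "g \<in> carrier G" "h \<in> carrier G"
    then show "right_shift G (g \<otimes>\<^bsub>G\<^esub> h) x = right_shift G g (right_shift G h x)"
      by (rule right_shift_mult[OF assms(1)])
  next
    fix x assume "x \<in> topspace (orbit_closure G a)"
    then show "right_shift G \<one>\<^bsub>G\<^esub> x = x" using one CE top by blast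
  qed
  moreover have "continuous_map (orbit_closure G a) euclidean (\<lambda>x. x \<one>\<^bsub>G\<^esub>)"
  proof -
    have 1: "continuous_map ?B (discrete_topology {0, 1}) (\<lambda>x. x \<one>\<^bsub>G\<^esub>)"
      unfolding binary_space_def by (rule continuous_map_product_projection) simp
    have 2: "continuous_map (discrete_topology {0, 1}) euclidean (\<lambda>z :: complex. z)"
      by simp
    have "continuous_map ?B euclidean (\<lambda>x. x \<one>\<^bsub>G\<^esub>)"
      using continuous_map_compose[OF 1 2] by (simp add: o_def)
    then show ?thesis
      unfolding orbit_closure_def by (rule continuous_map_from_subtopology)
  qed
  moreover have "transitive_point G (orbit_closure G a) (right_shift G) a"
    unfolding transitive_point_def top
    using aO OC unfolding orbit_closure_def
    by (auto simp: closure_of_subtopology Int_absorb1)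
  moreover have val: "right_shift G g x \<one>\<^bsub>G\<^esub> = x g" if "g \<in> carrier G" for g and x :: "'a \<Rightarrow> complex"
    using that by (simp add: right_shift_def)
  moreover have "orbit_separates_points G (orbit_closure G a) (right_shift G) (\<lambda>x. x \<one>\<^bsub>G\<^esub>)"
    unfolding orbit_separates_points_def top
  proof (intro ballI impI)
    fix x y assume "x \<in> ?C" "y \<in> ?C" "x \<noteq> y"
    then have "\<exists>g\<in>carrier G. x g \<noteq> y g"
      using CE by (meson PiE_ext subsetD)
    then show "\<exists>g\<in>carrier G. right_shift G g x \<one>\<^bsub>G\<^esub> \<noteq> right_shift G g y \<one>\<^bsub>G\<^esub>"
      using val by auto
  qed
  ultimately show ?thesis
    unfolding furstenberg_system_def by (intro conjI exI[of _ a] exI[of _ "\<lambda>x. x \<one>\<^bsub>G\<^esub>"]) auto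
qed

lemma isomorphic_points_iff_systems:
  assumes "group G" "furstenberg_system G a X T" "furstenberg_system G b Y S"
    and "a \<in> carrier G \<rightarrow>\<^sub>E {0, 1}" "b \<in> carrier G \<rightarrow>\<^sub>E {0, 1}"
  shows "isomorphic_points G a b \<longleftrightarrow> topologically_isomorphic G X T Y S"
proof
  assume "isomorphic_points G a b"
  then obtain X' T' Y' S' where X': "furstenberg_system G a (X' :: ('a \<Rightarrow> complex) topology) T'"
    and Y': "furstenberg_system G b (Y' :: ('a \<Rightarrow> complex) topology) S'"
    and iso: "topologically_isomorphic G X' T' Y' S'"
    by (auto simp: isomorphic_points_def)
  show "topologically_isomorphic G X T Y S"
    by (rule topologically_isomorphic_trans[OF furstenberg_system_unique[OF assms(1,2) X']
          topologically_isomorphic_trans[OF iso furstenberg_system_unique[OF assms(1) Y' assms(3)]]])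
next
  assume iso: "topologically_isomorphic G X T Y S"
  note a = furstenberg_system_orbit_closure[OF assms(1,4)]
    and b = furstenberg_system_orbit_closure[OF assms(1,5)]
  have "topologically_isomorphic G (orbit_closure G a) (right_shift G)
      (orbit_closure G b) (right_shift G)"
    by (rule topologically_isomorphic_trans[OF furstenberg_system_unique[OF assms(1) a assms(2)]
          topologically_isomorphic_trans[OF iso furstenberg_system_unique[OF assms(1,3) b]]])
  then show "isomorphic_points G a b"
    using a b unfolding isomorphic_points_def by blast
qed

lemma isomorphic_points_iff_orbit_closures:
  assumes "group G" "a \<in> carrier G \<rightarrow>\<^sub>E {0, 1}" "b \<in> carrier G \<rightarrow>\<^sub>E {0, 1}"
  shows "isomorphic_points G a b \<longleftrightarrow>
    topologically_isomorphic G (orbit_closure G a) (right_shift G) (orbit_closure G b) (right_shift G)"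
  by (rule isomorphic_points_iff_systems[OF assms(1)
        furstenberg_system_orbit_closure[OF assms(1,2)] furstenberg_system_orbit_closure[OF assms(1,3)] assms(2,3)])

end

theory Submission
  imports Defs
begin

text \<open>Transporting along an equivariant homeomorphism, \<open>a\<close> and \<open>b\<close> are isomorphic iff the orbit
  closure of \<open>b\<close> is itself a Furstenberg system of \<open>a\<close>. The witnesses \<open>F\<close> and \<open>x\<close> of the latter are
  those wanted, up to finite dependence, which is automatic: \<open>F\<close> takes values in \<open>{0,1}\<close> on a dense
  orbit, hence everywhere, so it is locally constant on a compact subspace of a product.\<close>

text \<open>Homeomorphisms commute with closures, and equivariance carries the orbit of
  \<open>x\<close> onto that of \<open>\<phi> x\<close>, so density passes across.\<close>

lemma transitive_point_homeomorphic_image: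
  assumes hom: "homeomorphic_map X Y \<phi>"
    and equiv: "\<And>g x. \<lbrakk>g \<in> carrier G; x \<in> topspace X\<rbrakk> \<Longrightarrow> \<phi> (T g x) = S g (\<phi> x)"
    and T: "\<And>g. g \<in> carrier G \<Longrightarrow> T g \<in> topspace X \<rightarrow> topspace X"
    and x: "transitive_point G X T x"
  shows "transitive_point G Y S (\<phi> x)"
proof -
  have xX: "x \<in> topspace X" and dense: "X closure_of ((\<lambda>g. T g x) ` carrier G) = topspace X"
    using x by (auto simp: transitive_point_def)
  have "(\<lambda>g. S g (\<phi> x)) ` carrier G = \<phi> ` ((\<lambda>g. T g x) ` carrier G)"
    using equiv xX by (auto simp: image_image)
  moreover have "Y closure_of (\<phi> ` ((\<lambda>g. T g x) ` carrier G)) = \<phi> ` (X closure_of ((\<lambda>g. T g x) ` carrier G))"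
    using T xX by (intro homeomorphic_map_closure_of[OF hom]) auto
  moreover have "\<phi> ` topspace X = topspace Y"
    using hom homeomorphic_imp_surjective_map by blast
  ultimately show ?thesis
    using xX dense by (auto simp: transitive_point_def)
qed

text \<open>With \<open>\<psi>\<close> inverse to \<open>\<phi>\<close>, the witnesses
  \<open>F\<close> and \<open>x\<close> become \<open>F \<circ> \<psi>\<close> and
  \<open>\<phi> x\<close>. Separation survives because \<open>\<psi>\<close> is injective and
  equivariant.\<close>

lemma furstenberg_system_isomorphic:
  assumes X: "furstenberg_system G f X T" and Y: "dynamical_system G Y S"
    and iso: "topologically_isomorphic G X T Y S"
  shows "furstenberg_system G f Y S"
proof -
  obtain F x where sys: "dynamical_system G X T" and F: "continuous_map X euclidean F"
    and x: "transitive_point G X T x" and f: "\<And>g. g \<in> carrier G \<Longrightarrow> f g = F (T g x)"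
    and sep: "orbit_separates_points G X T F"
    using X by (auto simp: furstenberg_system_def)
  have T: "T g \<in> topspace X \<rightarrow> topspace X" if "g \<in> carrier G" for g
    using sys that by (auto simp: dynamical_system_def continuous_map_def)
  obtain \<phi> where \<phi>: "homeomorphic_map X Y \<phi>"
    and equiv: "\<And>g x. \<lbrakk>g \<in> carrier G; x \<in> topspace X\<rbrakk> \<Longrightarrow> \<phi> (T g x) = S g (\<phi> x)"
    using iso by (auto simp: topologically_isomorphic_def)
  obtain \<psi> where maps: "homeomorphic_maps X Y \<phi> \<psi>"
    using \<phi> by (auto simp: homeomorphic_map_maps)
  have \<psi>: "continuous_map Y X \<psi>" and \<psi>\<phi>: "\<And>x. x \<in> topspace X \<Longrightarrow> \<psi> (\<phi> x) = x"
    and \<phi>\<psi>: "\<And>y. y \<in> topspace Y \<Longrightarrow> \<phi> (\<psi> y) = y"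
    using maps by (auto simp: homeomorphic_maps_def)
  have \<psi>X: "\<psi> y \<in> topspace X" if "y \<in> topspace Y" for y
    using \<psi> that by (auto simp: continuous_map_def)
  \<comment> \<open>Equivariance of \<open>\<phi>\<close> at \<open>\<psi> y\<close> reads
    \<open>\<phi> (T g (\<psi> y)) = S g y\<close>; apply \<open>\<psi>\<close> to both
    sides.\<close>
  have equiv': "\<psi> (S g y) = T g (\<psi> y)" if "g \<in> carrier G" "y \<in> topspace Y" for g y
    using equiv[OF that(1) \<psi>X[OF that(2)]] \<psi>\<phi>[of "T g (\<psi> y)"] \<phi>\<psi>[OF that(2)]
      T[OF that(1)] \<psi>X[OF that(2)] by auto
  have xX: "x \<in> topspace X"
    using x by (simp add: transitive_point_def)
  have "continuous_map Y euclidean (F \<circ> \<psi>)"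
    using continuous_map_compose[OF \<psi> F] .
  moreover have "transitive_point G Y S (\<phi> x)"
    using transitive_point_homeomorphic_image[OF \<phi> equiv T x] .
  moreover have "f g = (F \<circ> \<psi>) (S g (\<phi> x))" if "g \<in> carrier G" for g
    using that f equiv xX \<psi>\<phi>[of "T g x"] T[OF that] by (simp add: Pi_iff flip: equiv)
  moreover have "orbit_separates_points G Y S (F \<circ> \<psi>)"
    unfolding orbit_separates_points_def
  proof (intro ballI impI)
    fix y z assume yz: "y \<in> topspace Y" "z \<in> topspace Y" "y \<noteq> z"
    then have "\<psi> y \<noteq> \<psi> z"
      using \<phi>\<psi> by metis
    then obtain g where "g \<in> carrier G" "F (T g (\<psi> y)) \<noteq> F (T g (\<psi> z))"
      using sep \<psi>X[OF yz(1)] \<psi>X[OF yz(2)] unfolding orbit_separates_points_def by blast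
    then show "\<exists>g\<in>carrier G. (F \<circ> \<psi>) (S g y) \<noteq> (F \<circ> \<psi>) (S g z)"
      using equiv' yz by auto
  qed
  ultimately show ?thesis
    using Y unfolding furstenberg_system_def by blast
qed

text \<open>This trades the existential over pairs of systems for a single concrete system. Forward,
  the structure of the orbit closure of \<open>a\<close> is transported; backward, both orbit
  closures are Furstenberg systems of \<open>a\<close>, so uniqueness makes them isomorphic.\<close>

lemma isomorphic_points_iff_furstenberg_system:
  assumes "group G" "a \<in> carrier G \<rightarrow>\<^sub>E {0, 1}" "b \<in> carrier G \<rightarrow>\<^sub>E {0, 1}"
  shows "isomorphic_points G a b \<longleftrightarrow> furstenberg_system G a (orbit_closure G b) (right_shift G)"
proof
  note a = furstenberg_system_orbit_closure[OF assms(1,2)]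
    and b = furstenberg_system_orbit_closure[OF assms(1,3)]
  have "dynamical_system G (orbit_closure G b) (right_shift G)"
    using b by (simp add: furstenberg_system_def)
  then show "furstenberg_system G a (orbit_closure G b) (right_shift G)" if "isomorphic_points G a b"
    using furstenberg_system_isomorphic[OF a] that isomorphic_points_iff_orbit_closures[OF assms]
    by blast
  show "isomorphic_points G a b" if "furstenberg_system G a (orbit_closure G b) (right_shift G)"
    using furstenberg_system_unique[OF assms(1) a that]
    by (simp add: isomorphic_points_iff_orbit_closures[OF assms])
qed

text \<open>By continuity and density of the orbit, every value of \<open>F\<close> lies in the
  closure of its values on the orbit.\<close>

lemma transitive_point_range_subset_closed:
  assumes "continuous_map X Z F" "transitive_point G X T x" "closedin Z C"
    and "\<And>g. g \<in> carrier G \<Longrightarrow> F (T g x) \<in> C"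
  shows "F ` topspace X \<subseteq> C"
proof -
  have "F ` topspace X \<subseteq> Z closure_of (F ` ((\<lambda>g. T g x) ` carrier G))"
    using continuous_map_image_closure_subset[OF assms(1), of "(\<lambda>g. T g x) ` carrier G"] assms(2)
    by (simp add: transitive_point_def)
  also have "\<dots> \<subseteq> C"
    using assms(3,4) by (intro closure_of_minimal) auto
  finally show ?thesis .
qed

text \<open>Around each point, \<open>f\<close> is constant on a basic open set, which restricts
  only finitely many coordinates. By compactness finitely many such sets cover the space, and all
  their restricted coordinates together still form a finite set.\<close>

lemma continuous_map_discrete_finite_dependence:
  assumes comp: "compact_space (subtopology (product_topology X I) S)"
    and f: "continuous_map (subtopology (product_topology X I) S) (discrete_topology D) f"
  shows "\<exists>A. finite A \<and> A \<subseteq> I \<and>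
    (\<forall>x\<in>topspace (subtopology (product_topology X I) S).
      \<forall>y\<in>topspace (subtopology (product_topology X I) S). (\<forall>i\<in>A. x i = y i) \<longrightarrow> f x = f y)"
proof -
  let ?P = "product_topology X I"
  let ?Y = "subtopology ?P S"
  \<comment> \<open>The condition is asymmetric: \<open>x\<close> is confined to \<open>V\<close>,
    while \<open>y\<close> ranges over the whole space. In the final step it therefore suffices to
    locate one of the two points in the cover.\<close>
  define determined where "determined A V \<longleftrightarrow> finite A \<and> A \<subseteq> I \<and>
    (\<forall>x\<in>V. \<forall>y\<in>topspace ?Y. (\<forall>i\<in>A. x i = y i) \<longrightarrow> f x = f y)" for A V
  define \<U> where "\<U> = {V. openin ?Y V \<and> (\<exists>A. determined A V)}"
  have "\<exists>V\<in>\<U>. x \<in> V" if x: "x \<in> topspace ?Y" for x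
  proof -
    \<comment> \<open>Singletons are open in a discrete space, so the fibre of \<open>f\<close>
      through \<open>x\<close> is open.\<close>
    have "openin ?Y {y \<in> topspace ?Y. f y \<in> {f x}}"
      using f x by (intro openin_continuous_map_preimage[OF f]) (auto simp: continuous_map_def)
    then obtain W where W: "openin ?P W" "{y \<in> topspace ?Y. f y = f x} = W \<inter> S"
      by (auto simp: openin_subtopology)
    then have "x \<in> W"
      using x by blast
    then have "\<exists>U. finite {i \<in> I. U i \<noteq> topspace (X i)} \<and> (\<forall>i\<in>I. openin (X i) (U i)) \<and>
        x \<in> Pi\<^sub>E I U \<and> Pi\<^sub>E I U \<subseteq> W"
      using W(1) by (simp add: openin_product_topology_alt)
    then obtain U where U: "finite {i \<in> I. U i \<noteq> topspace (X i)}" "\<And>i. i \<in> I \<Longrightarrow> openin (X i) (U i)"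
      "x \<in> Pi\<^sub>E I U" "Pi\<^sub>E I U \<subseteq> W"
      by (elim exE conjE) simp
    \<comment> \<open>These are the coordinates that the basic open set really restricts.\<close>
    define A where "A = {i \<in> I. U i \<noteq> topspace (X i)}"
    have sub: "Pi\<^sub>E I U \<inter> S \<subseteq> {y \<in> topspace ?Y. f y = f x}"
      using U(4) W(2) by auto
    have "f z = f y" if z: "z \<in> Pi\<^sub>E I U \<inter> S" and y: "y \<in> topspace ?Y" and zy: "\<forall>i\<in>A. z i = y i" for y z
    proof -
      have yX: "y \<in> (\<Pi>\<^sub>E i\<in>I. topspace (X i))" "y \<in> S"
        using y by auto
      \<comment> \<open>On \<open>A\<close> the point \<open>y\<close> copies \<open>z\<close>; off
        \<open>A\<close> the factor \<open>U i\<close> is the whole space. So \<open>y\<close> falls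
        into the same box as \<open>z\<close>, where \<open>f\<close> is constantly
        \<open>f x\<close>.\<close>
      have "y i \<in> U i" if "i \<in> I" for i
      proof (cases "i \<in> A")
        case True
        then show ?thesis
          using z zy that PiE_mem[of z I U i] by auto
      next
        case False
        then show ?thesis
          using PiE_mem[OF yX(1) that] that by (simp add: A_def)
      qed
      then have "y \<in> Pi\<^sub>E I U \<inter> S"
        using yX by (simp add: PiE_iff)
      then have "f y = f x"
        using sub by blast
      moreover have "f z = f x"
        using sub z by blast
      ultimately show ?thesis
        by simp
    qed
    then have "determined A (Pi\<^sub>E I U \<inter> S)"
      using U(1) by (simp add: determined_def A_def)
    moreover have "openin ?Y (Pi\<^sub>E I U \<inter> S)"
      using U(1,2) by (intro openin_subtopology_Int) (simp add: openin_PiE_gen)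
    ultimately have "Pi\<^sub>E I U \<inter> S \<in> \<U>"
      by (auto simp: \<U>_def)
    moreover have "x \<in> Pi\<^sub>E I U \<inter> S"
      using U(3) x by simp
    ultimately show ?thesis
      by blast
  qed
  then have "topspace ?Y \<subseteq> \<Union>\<U>" "\<forall>V\<in>\<U>. openin ?Y V"
    by (auto simp: \<U>_def)
  then obtain \<F> where \<F>: "finite \<F>" "\<F> \<subseteq> \<U>" "topspace ?Y \<subseteq> \<Union>\<F>"
    using comp unfolding compact_space_alt by meson
  then have "\<forall>V\<in>\<F>. \<exists>A. determined A V"
    by (auto simp: \<U>_def)
  then obtain A where A: "\<And>V. V \<in> \<F> \<Longrightarrow> determined (A V) V"
    by metis
  have "finite (\<Union>V\<in>\<F>. A V)" "(\<Union>V\<in>\<F>. A V) \<subseteq> I"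
    using A \<F>(1) by (auto simp: determined_def)
  moreover have "f x = f y"
    if xy: "x \<in> topspace ?Y" "y \<in> topspace ?Y" "\<forall>i\<in>(\<Union>V\<in>\<F>. A V). x i = y i" for x y
  proof -
    obtain V where "V \<in> \<F>" "x \<in> V"
      using \<F>(3) xy(1) by blast
    then show ?thesis
      using A[of V] xy(2,3) unfolding determined_def by blast
  qed
  ultimately show ?thesis
    by (intro exI[of _ "\<Union>V\<in>\<F>. A V"] conjI ballI impI)
qed

theorem theorem3p8:
  fixes G :: "('g, 'm) monoid_scheme" and a b :: "'g \<Rightarrow> complex"
  assumes "group G"
    and "a \<in> topspace (binary_space G)" and "b \<in> topspace (binary_space G)"
  shows "isomorphic_points G a b \<longleftrightarrow>
    (\<exists>F x. generalised_projection G (orbit_closure G b) F \<and>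
      transitive_point G (orbit_closure G b) (right_shift G) x \<and>
      (\<forall>g\<in>carrier G. F (right_shift G g x) = a g))"
proof -
  let ?Y = "orbit_closure G b"
  have a: "a \<in> carrier G \<rightarrow>\<^sub>E {0, 1}" and b: "b \<in> carrier G \<rightarrow>\<^sub>E {0, 1}"
    using assms(2,3) by (simp_all add: topspace_binary_space)
  have sys: "dynamical_system G ?Y (right_shift G)"
    using furstenberg_system_orbit_closure[OF assms(1) b] by (simp add: furstenberg_system_def)
  \<comment> \<open>This supplies the one property of a generalised projection that a Furstenberg
    system does not state.\<close>
  have fin: "depends_on_finitely_many G ?Y F"
    if F: "continuous_map ?Y euclidean F" and x: "transitive_point G ?Y (right_shift G) x"
      and val: "\<forall>g\<in>carrier G. a g = F (right_shift G g x)" for F x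
  proof -
    \<comment> \<open>On the orbit of \<open>x\<close> the values of \<open>F\<close> are those of
      \<open>a\<close>; as \<open>{0, 1}\<close> is closed, they fill out no further on the orbit
      closure.\<close>
    have "F (right_shift G g x) \<in> {0, 1}" if "g \<in> carrier G" for g
      using a val that by (metis PiE_mem)
    then have "F ` topspace ?Y \<subseteq> {0, 1}"
      using transitive_point_range_subset_closed[OF F x, of "{0, 1}"] by simp
    then have "continuous_map ?Y (subtopology euclidean {0, 1}) F"
      using F by (auto simp: continuous_map_in_subtopology)
    \<comment> \<open>A finite set of complex numbers has no accumulation points, so its subspace
      topology is discrete.\<close>
    also have "subtopology euclidean {0, 1} = discrete_topology {0, 1 :: complex}"
      by (auto simp: subtopology_eq_discrete_topology_eq derived_set_of_infinite_openin)
    finally have disc: "continuous_map ?Y (discrete_topology {0, 1}) F" .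
    have comp: "compact_space ?Y"
      using sys by (simp add: dynamical_system_def)
    show ?thesis
      using comp disc unfolding depends_on_finitely_many_def orbit_closure_def binary_space_def
      by (rule continuous_map_discrete_finite_dependence)
  qed
  have "isomorphic_points G a b \<longleftrightarrow> furstenberg_system G a ?Y (right_shift G)"
    by (rule isomorphic_points_iff_furstenberg_system[OF assms(1) a b])
  \<comment> \<open>The same \<open>F\<close> and \<open>x\<close> serve both sides:
    \<open>fin\<close> adds finite dependence in one direction, \<open>sys\<close> the dynamical
    system in the other.\<close>
  also have "\<dots> \<longleftrightarrow> (\<exists>F x. generalised_projection G ?Y F \<and>
      transitive_point G ?Y (right_shift G) x \<and> (\<forall>g\<in>carrier G. F (right_shift G g x) = a g))"
    (is "_ \<longleftrightarrow> ?R")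
  proof
    assume "furstenberg_system G a ?Y (right_shift G)"
    then obtain F x where "continuous_map ?Y euclidean F" "transitive_point G ?Y (right_shift G) x"
      "\<forall>g\<in>carrier G. a g = F (right_shift G g x)" "orbit_separates_points G ?Y (right_shift G) F"
      unfolding furstenberg_system_def by blast
    then show ?R
      using fin[of F x] unfolding generalised_projection_def by (intro exI[of _ F] exI[of _ x]) auto
  next
    assume ?R
    then obtain F x where "continuous_map ?Y euclidean F" "transitive_point G ?Y (right_shift G) x"
      "\<forall>g\<in>carrier G. F (right_shift G g x) = a g" "orbit_separates_points G ?Y (right_shift G) F"
      unfolding generalised_projection_def by blast
    then show "furstenberg_system G a ?Y (right_shift G)"
      using sys unfolding furstenberg_system_def by (intro conjI exI[of _ F] exI[of _ x]) auto
  qed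
  finally show ?thesis .
qed

end
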